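(* Let $K$ be a differential ring, $L$ a differential $K$-algebra, and $T$ a $K$-Taylor morphism for $L$. Let $A$ be a differential $K$-algebra with structure map $\eta_A: K\to A$, and let $\phi: A \to K$ be a $K$-algebra homomorphism. Then $T_\phi: A \to L$ is a differential $K$-algebra homomorphism.
   Context: All rings are commutative and unital, of arbitrary characteristic. Fix a number $m$; a differential ring is a ring with an $m$-tuple of pairwise commuting derivations; differential ring homomorphisms are ring homomorphisms commuting with the respective derivations. For a differential ring $K$, a differential $K$-algebra is a differential ring $A$ equipped with a differential ring homomorphism $\eta_A: K \to A$ (the structure map). $K$ is a differential $K$-algebra via the identity. A $K$-algebra homomorphism between differential $K$-algebras is a ring homomorphism compatible with the structure maps (not necessarily differential); it is a differential $K$-algebra homomorphism if it is also differential. Let $K$ be a differential ring and $L$ a differential $K$-algebra. A $K$-Taylor morphism for $L$ is a map $T$ which sends pairs $(A,\phi)$, where $A$ is a differential ring and $\phi: A \to K$ is a (not necessarily differential) ring homomorphism, to a differential ring homomorphism $T_\phi: A \to L$, such that: (TM1) if $\phi: A\to K$ is differential, then $T_\phi = \eta_L \circ \phi$; (TM2) if $A,B$ are differential rings, $\phi: A \to K$, $\psi: B \to K$ ring homomorphisms and $\chi: A \to B$ a differential ring homomorphism with $\phi = \psi\circ\chi$, then $T_\phi = T_\psi\circ\chi$. *)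

theory Defs
  imports "HOL-Algebra.Ring"
begin

record 'a diff_ring = "'a ring" +
  der :: "nat \<Rightarrow> 'a \<Rightarrow> 'a"

text \<open>
  The m-tuple of derivations of a differential ring is \<open>der R 0, ..., der R (m - 1)\<close>; the value of
  \<open>der R i\<close> for \<open>i \<ge> m\<close> is irrelevant, as is the value of any map outside the carrier of its
  domain. As in HOL-Algebra, rings may be zero.
\<close>

definition derivation :: "('a, 'b) ring_scheme \<Rightarrow> ('a \<Rightarrow> 'a) \<Rightarrow> bool" where
  "derivation R d \<longleftrightarrow>
     d \<in> carrier R \<rightarrow> carrier R \<and>
     (\<forall>x\<in>carrier R. \<forall>y\<in>carrier R. d (x \<oplus>\<^bsub>R\<^esub> y) = d x \<oplus>\<^bsub>R\<^esub> d y) \<and>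
     (\<forall>x\<in>carrier R. \<forall>y\<in>carrier R. d (x \<otimes>\<^bsub>R\<^esub> y) = d x \<otimes>\<^bsub>R\<^esub> y \<oplus>\<^bsub>R\<^esub> x \<otimes>\<^bsub>R\<^esub> d y)"

locale differential_ring = cring R
  for m :: nat and R :: "'a diff_ring" (structure) +
  assumes der_derivation: "i < m \<Longrightarrow> derivation R (der R i)"
    and der_commute:
      "\<lbrakk>i < m; j < m; x \<in> carrier R\<rbrakk> \<Longrightarrow> der R i (der R j x) = der R j (der R i x)"

definition diff_ring_hom :: "nat \<Rightarrow> 'a diff_ring \<Rightarrow> 'b diff_ring \<Rightarrow> ('a \<Rightarrow> 'b) set" where
  "diff_ring_hom m R S =
     {h \<in> ring_hom R S. \<forall>i<m. \<forall>x\<in>carrier R. h (der R i x) = der S i (h x)}"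

locale diff_algebra = K: differential_ring m K + A: differential_ring m A
  for m :: nat and K :: "'k diff_ring" and A :: "'a diff_ring" and \<eta> :: "'k \<Rightarrow> 'a" +
  assumes structure_map: "\<eta> \<in> diff_ring_hom m K A"

definition algebra_hom ::
  "'k diff_ring \<Rightarrow> 'a diff_ring \<Rightarrow> ('k \<Rightarrow> 'a) \<Rightarrow> 'b diff_ring \<Rightarrow> ('k \<Rightarrow> 'b) \<Rightarrow> ('a \<Rightarrow> 'b) set" where
  "algebra_hom K A \<eta>\<^sub>A B \<eta>\<^sub>B = {f \<in> ring_hom A B. \<forall>k\<in>carrier K. f (\<eta>\<^sub>A k) = \<eta>\<^sub>B k}"

definition diff_algebra_hom ::
  "nat \<Rightarrow> 'k diff_ring \<Rightarrow> 'a diff_ring \<Rightarrow> ('k \<Rightarrow> 'a) \<Rightarrow> 'b diff_ring \<Rightarrow> ('k \<Rightarrow> 'b) \<Rightarrow> ('a \<Rightarrow> 'b) set" where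
  "diff_algebra_hom m K A \<eta>\<^sub>A B \<eta>\<^sub>B = algebra_hom K A \<eta>\<^sub>A B \<eta>\<^sub>B \<inter> diff_ring_hom m A B"

text \<open>
  A K-Taylor morphism is defined on all pairs of a differential ring \<open>A\<close> and a ring homomorphism
  \<open>\<phi>\<close> from \<open>A\<close> to \<open>K\<close>; its value there is \<open>T A \<phi>\<close>. The type \<open>'u\<close> is the universe over which
  \<open>A\<close> ranges: every differential ring whose carrier is a set of elements of \<open>'u\<close>. The base ring
  \<open>K\<close> belongs to this universe; \<open>L\<close> need not. Equations between maps are required on the carrier
  only. That \<open>T A \<phi>\<close> on the carrier does not depend on the values of \<open>\<phi>\<close> and of the operations
  of \<open>A\<close> outside the carrier is the case of \<open>TM2\<close> in which \<open>\<chi>\<close> is the identity.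
\<close>

locale taylor_morphism = diff_algebra m K L \<eta>\<^sub>L
  for m :: nat and K :: "'u diff_ring" and L :: "'l diff_ring" and \<eta>\<^sub>L :: "'u \<Rightarrow> 'l" +
  fixes T :: "'u diff_ring \<Rightarrow> ('u \<Rightarrow> 'u) \<Rightarrow> 'u \<Rightarrow> 'l"
  assumes T_hom: "\<And>A \<phi>. \<lbrakk>differential_ring m A; \<phi> \<in> ring_hom A K\<rbrakk> \<Longrightarrow> T A \<phi> \<in> diff_ring_hom m A L"
    and TM1: "\<And>A \<phi> a. \<lbrakk>differential_ring m A; \<phi> \<in> diff_ring_hom m A K; a \<in> carrier A\<rbrakk>
      \<Longrightarrow> T A \<phi> a = \<eta>\<^sub>L (\<phi> a)"
    and TM2: "\<And>A B \<phi> \<psi> \<chi> a. \<lbrakk>differential_ring m A; differential_ring m B;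
        \<phi> \<in> ring_hom A K; \<psi> \<in> ring_hom B K; \<chi> \<in> diff_ring_hom m A B;
        \<And>x. x \<in> carrier A \<Longrightarrow> \<phi> x = \<psi> (\<chi> x); a \<in> carrier A\<rbrakk>
      \<Longrightarrow> T A \<phi> a = T B \<psi> (\<chi> a)"

end

theory Submission
  imports Defs
begin

text \<open>That \<open>\<phi>\<close> is a \<open>K\<close>-algebra homomorphism means that
  \<open>\<eta>\<^sub>A\<close> is a section of it: \<open>\<phi>\<close> after
  \<open>\<eta>\<^sub>A\<close> is the identity of \<open>K\<close>. Since
  \<open>\<eta>\<^sub>A\<close> is differential, \<open>TM2\<close> turns this factorization into
  \<open>T K id\<close> = \<open>T A \<phi>\<close> after \<open>\<eta>\<^sub>A\<close>, while
  \<open>TM1\<close> evaluates \<open>T K id\<close> as \<open>\<eta>\<^sub>L\<close>. So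
  \<open>T A \<phi>\<close>, differential by \<open>T_hom\<close>, respects the structure
  maps.\<close>

lemma id_diff_ring_hom: "id \<in> diff_ring_hom m K K"
  by (simp add: diff_ring_hom_def ring_hom_def)

theorem proposition4p6:
  fixes m :: nat
    and K :: "'u diff_ring" and L :: "'l diff_ring" and A :: "'u diff_ring"
    and \<eta>\<^sub>L :: "'u \<Rightarrow> 'l" and \<eta>\<^sub>A :: "'u \<Rightarrow> 'u"
    and T :: "'u diff_ring \<Rightarrow> ('u \<Rightarrow> 'u) \<Rightarrow> 'u \<Rightarrow> 'l"
    and \<phi> :: "'u \<Rightarrow> 'u"
  assumes "differential_ring m K"
    and "diff_algebra m K L \<eta>\<^sub>L"
    and "taylor_morphism m K L \<eta>\<^sub>L T"
    and "diff_algebra m K A \<eta>\<^sub>A"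
    and "\<phi> \<in> algebra_hom K A \<eta>\<^sub>A K id"
  shows "T A \<phi> \<in> diff_algebra_hom m K A \<eta>\<^sub>A L \<eta>\<^sub>L"
proof -
  interpret taylor_morphism m K L \<eta>\<^sub>L T by fact
  interpret A: diff_algebra m K A \<eta>\<^sub>A by fact
  have \<phi>: "\<phi> \<in> ring_hom A K" "\<And>k. k \<in> carrier K \<Longrightarrow> \<phi> (\<eta>\<^sub>A k) = k"
    using assms(5) by (auto simp: algebra_hom_def)
  have T: "T A \<phi> \<in> diff_ring_hom m A L"
    using A.A.differential_ring_axioms \<phi>(1) by (rule T_hom)
  have id: "id \<in> ring_hom K K"
    using id_diff_ring_hom by (auto simp: diff_ring_hom_def)
  have "T A \<phi> (\<eta>\<^sub>A k) = \<eta>\<^sub>L k" if k: "k \<in> carrier K" for k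
  proof -
    \<comment> \<open>\<open>TM2\<close> with \<chi> the structure map
      \<open>\<eta>\<^sub>A\<close>, from the pair (\<open>K\<close>, \<open>id\<close>) to
      (\<open>A\<close>, \<open>\<phi>\<close>). The pair (\<open>K\<close>, \<open>id\<close>) is
      admissible because \<open>K\<close> lies in the universe \<open>'u\<close>.\<close>
    have "T K id k = T A \<phi> (\<eta>\<^sub>A k)"
      by (rule TM2[OF assms(1) A.A.differential_ring_axioms id \<phi>(1) A.structure_map _ k])
        (simp add: \<phi>(2))
    \<comment> \<open>\<open>TM1\<close> is applied to \<open>id\<close>, which is differential,
      whereas \<open>\<phi>\<close> may fail to be.\<close>
    moreover have "T K id k = \<eta>\<^sub>L k"
      using TM1[OF assms(1) id_diff_ring_hom k] by simp
    ultimately show ?thesis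
      by simp
  qed
  with T show ?thesis
    by (auto simp: diff_algebra_hom_def algebra_hom_def diff_ring_hom_def)
qed

end
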